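(* Let $n$ be a positive integer with $\omega(n)\ge 2$. Then $\tilde{\Gamma}_{\mathcal{H}}(\mathbb{Z}_n)$ is a star hypergraph if and only if $n=p_1^{\alpha_1}p_2$ for some distinct prime numbers $p_1,p_2$ and some positive integer $\alpha_1$.
   Context: $\omega(n)$ denotes the number of distinct prime divisors of $n$. A hypergraph is a pair $(V,E)$ with $E$ a set of subsets of $V$ (hyperedges). A hypergraph is called a star if there is a vertex which belongs to all hyperedges. For a group $G$ with identity $e$, let $S$ be the set of all non-trivial proper subgroups of $G$. The intersection hypergraph $\tilde{\Gamma}_{\mathcal{H}}(G)$ has vertex set $V=\{H\in S : H\cap K=\{e\}\text{ for some }K\in S\}$, and $E\subseteq V$ is a hyperedge if and only if (1) for distinct $H,K\in E$, $H\cap K=\{e\}$; and (2) there is no $E'\subseteq V$ with $E'\supsetneq E$ satisfying (1). *)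

theory Defs
  imports "HOL-Algebra.Elementary_Groups" "HOL-Computational_Algebra.Primes"
begin

definition omega :: "nat \<Rightarrow> nat" where
  "omega n = card (prime_factors n)"

type_synonym 'v hypergraph = "'v set \<times> 'v set set"

definition star_hypergraph :: "'v hypergraph \<Rightarrow> bool" where
  "star_hypergraph X \<longleftrightarrow> (\<exists>v\<in>fst X. \<forall>E\<in>snd X. v \<in> E)"

definition nontrivial_proper_subgroups :: "('a, 'b) monoid_scheme \<Rightarrow> 'a set set" where
  "nontrivial_proper_subgroups G = {H. subgroup H G \<and> H \<noteq> {\<one>\<^bsub>G\<^esub>} \<and> H \<noteq> carrier G}"

definition intersection_vertices :: "('a, 'b) monoid_scheme \<Rightarrow> 'a set set" where
  "intersection_vertices G =
     {H \<in> nontrivial_proper_subgroups G.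
        \<exists>K \<in> nontrivial_proper_subgroups G. H \<inter> K = {\<one>\<^bsub>G\<^esub>}}"

definition pairwise_trivial_intersection :: "('a, 'b) monoid_scheme \<Rightarrow> 'a set set \<Rightarrow> bool" where
  "pairwise_trivial_intersection G E \<longleftrightarrow> (\<forall>H\<in>E. \<forall>K\<in>E. H \<noteq> K \<longrightarrow> H \<inter> K = {\<one>\<^bsub>G\<^esub>})"

definition intersection_hyperedges :: "('a, 'b) monoid_scheme \<Rightarrow> 'a set set set" where
  "intersection_hyperedges G =
     {E. E \<subseteq> intersection_vertices G \<and> pairwise_trivial_intersection G E \<and>
         \<not> (\<exists>E'. E' \<subseteq> intersection_vertices G \<and> E \<subset> E' \<and> pairwise_trivial_intersection G E')}"

definition intersection_hypergraph :: "('a, 'b) monoid_scheme \<Rightarrow> 'a set hypergraph" where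
  "intersection_hypergraph G = (intersection_vertices G, intersection_hyperedges G)"

end

theory Submission
  imports Defs
begin

text \<open>For a finite group, every set \<open>{w}\<close> of one vertex extends to a hyperedge, so the star centres
  are the vertices meeting every other vertex trivially. The subgroups of \<open>\<int>\<^sub>n\<close> are its
  \<open>m\<close>-torsion subgroups for \<open>m\<close> dividing \<open>n\<close>, two of which meet trivially iff their indices are
  coprime. If the \<open>m\<close>-torsion is a centre and \<open>q\<close> is a prime dividing \<open>m\<close>, comparison with the
  \<open>q\<close>-torsion gives \<open>m = q\<close>. Choose another prime \<open>p\<close> dividing \<open>n\<close>. For a prime \<open>r \<noteq> p\<close> with
  \<open>q r\<close> dividing \<open>n\<close> (possibly \<open>r = q\<close>), the \<open>q r\<close>-torsion would be a vertex meeting the centre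
  nontrivially. Hence \<open>n / q\<close> is a power of \<open>p\<close>. Conversely, for
  \<open>n = p\<^sup>a q\<close> the \<open>q\<close>-torsion is a centre, since every other vertex is the \<open>p\<^sup>i\<close>-torsion for some \<open>i\<close>.\<close>

section \<open>Star centres in a finite group\<close>

lemma (in group) star_intersection_hypergraph_iff:
  assumes "finite (carrier G)"
  shows "star_hypergraph (intersection_hypergraph G) \<longleftrightarrow>
    (\<exists>v\<in>intersection_vertices G. \<forall>w\<in>intersection_vertices G. w \<noteq> v \<longrightarrow> v \<inter> w = {\<one>})"
    (is "?L \<longleftrightarrow> ?R")
proof
  have "intersection_vertices G \<subseteq> Pow (carrier G)"
    by (auto simp: intersection_vertices_def nontrivial_proper_subgroups_def
        dest: subgroup.subset)
  then have fin: "finite (intersection_vertices G)"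
    using assms by (meson finite_Pow_iff finite_subset)
  define C where "C = {E. E \<subseteq> intersection_vertices G \<and> pairwise_trivial_intersection G E}"
  have finC: "finite C"
    using fin by (simp add: C_def)
  assume ?L
  then obtain v where v: "v \<in> intersection_vertices G"
    and centre: "\<And>E. E \<in> intersection_hyperedges G \<Longrightarrow> v \<in> E"
    by (auto simp: star_hypergraph_def intersection_hypergraph_def)
  have "v \<inter> w = {\<one>}" if w: "w \<in> intersection_vertices G" "w \<noteq> v" for w
  proof -
    have "{w} \<in> C"
      using w by (auto simp: C_def pairwise_trivial_intersection_def)
    \<comment> \<open>Finiteness of the group enters here: it makes \<open>C\<close> finite, so a
      maximal member above \<open>{w}\<close> exists. Such a member is a hyperedge and hence
      contains \<open>v\<close> as well as \<open>w\<close>.\<close>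
    then obtain E where E: "E \<in> C" "{w} \<subseteq> E" and max: "\<forall>E'\<in>C. E \<subseteq> E' \<longrightarrow> E = E'"
      using finite_has_maximal2[OF finC] by blast
    then have "E \<in> intersection_hyperedges G"
      by (auto simp: C_def intersection_hyperedges_def)
    then show ?thesis
      using centre E w by (auto simp: C_def pairwise_trivial_intersection_def)
  qed
  with v show ?R by blast
next
  assume ?R
  then obtain v where v: "v \<in> intersection_vertices G"
    and triv: "\<And>w. w \<in> intersection_vertices G \<Longrightarrow> w \<noteq> v \<Longrightarrow> v \<inter> w = {\<one>}"
    by blast
  have "v \<in> E" if E: "E \<in> intersection_hyperedges G" for E
  proof (rule ccontr)
    assume "v \<notin> E"
    \<comment> \<open>Adjoining \<open>v\<close> keeps the intersections trivial, which contradicts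
      the maximality of \<open>E\<close>.\<close>
    then have "E \<subset> insert v E" by blast
    moreover have "insert v E \<subseteq> intersection_vertices G"
      using E v by (simp add: intersection_hyperedges_def)
    moreover have "pairwise_trivial_intersection G (insert v E)"
    proof -
      have "v \<inter> w = {\<one>}" "w \<inter> v = {\<one>}" if "w \<in> E" "w \<noteq> v" for w
        using triv[of w] that E by (auto simp: intersection_hyperedges_def Int_commute)
      moreover have "pairwise_trivial_intersection G E"
        using E by (simp add: intersection_hyperedges_def)
      ultimately show ?thesis by (simp add: pairwise_trivial_intersection_def)
    qed
    ultimately show False
      using E unfolding intersection_hyperedges_def by blast
  qed
  with v show ?L
    by (auto simp: star_hypergraph_def intersection_hypergraph_def)
qed

section \<open>Torsion subgroups of the integers modulo \<open>n\<close>\<close>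

text \<open>For \<open>m\<close> dividing \<open>n > 0\<close> these are the multiples of
  \<open>n div m\<close>, the subgroup of order \<open>m\<close>. Indexing by order turns inclusion
  into divisibility and intersection into gcd.\<close>

definition torsion :: "nat \<Rightarrow> nat \<Rightarrow> int set" where
  "torsion n m = {x \<in> {0..<int n}. int n dvd int m * x}"

lemma torsion_1: "n > 0 \<Longrightarrow> torsion n 1 = {0}"
  by (auto simp: torsion_def dest: zdvd_imp_le)

lemma torsion_self: "n > 0 \<Longrightarrow> torsion n n = carrier (integer_mod_group n)"
  by (auto simp: torsion_def carrier_integer_mod_group)

lemma torsion_Int: "torsion n a \<inter> torsion n b = torsion n (gcd a b)"
proof -
  have "int n dvd int a * x \<and> int n dvd int b * x \<longleftrightarrow> int n dvd int (gcd a b) * x" for x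
  proof -
    have "int n dvd int a * x \<and> int n dvd int b * x \<longleftrightarrow> int n dvd gcd (int a * x) (int b * x)"
      by simp
    \<comment> \<open>Integer gcds are nonnegative, so \<open>normalize\<close> absorbs the sign of
      \<open>x\<close>; divisibility ignores it.\<close>
    also have "gcd (int a * x) (int b * x) = normalize (int (gcd a b) * x)"
      using gcd_mult_right[of "int a" x "int b"] by (simp add: gcd.commute)
    finally show ?thesis by (simp only: dvd_normalize_iff)
  qed
  then show ?thesis by (auto simp: torsion_def)
qed

lemma torsion_subset_iff:
  assumes "n > 0" "a dvd n"
  shows "torsion n a \<subseteq> torsion n b \<longleftrightarrow> a dvd b"
proof
  obtain k where k: "n = a * k" using assms by blast
  assume sub: "torsion n a \<subseteq> torsion n b"
  \<comment> \<open>The generator \<open>k\<close> of the \<open>a\<close>-torsion is tested for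
    membership in the \<open>b\<close>-torsion. For \<open>a = 1\<close> it equals \<open>n\<close>,
    which is not among the representatives, hence the case split.\<close>
  show "a dvd b"
  proof (cases "a = 1")
    case False
    then have "k < n" using k assms by (cases a) auto
    then have "int k \<in> torsion n a"
      using k by (auto simp: torsion_def)
    then have "int (a * k) dvd int (b * k)"
      using sub k by (fastforce simp: torsion_def)
    then have "a * k dvd b * k"
      using int_dvd_int_iff by blast
    then show ?thesis using k assms by simp
  qed simp
next
  assume "a dvd b"
  then show "torsion n a \<subseteq> torsion n b"
    unfolding torsion_def by (auto intro: dvd_trans mult_dvd_mono)
qed

lemma torsion_eq_iff:
  assumes "n > 0" "a dvd n" "b dvd n"
  shows "torsion n a = torsion n b \<longleftrightarrow> a = b"
  using assms torsion_subset_iff by (metis dvd_antisym dvd_refl set_eq_subset)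

lemma subgroup_torsion:
  assumes "n > 0"
  shows "subgroup (torsion n m) (integer_mod_group n)"
proof -
  interpret group "integer_mod_group n" by simp
  have mod: "int n dvd int m * (x mod int n) \<longleftrightarrow> int n dvd int m * x" for x
    by (simp add: dvd_eq_mod_eq_0 mod_mult_right_eq)
  show ?thesis
  proof (rule subgroupI)
    show "torsion n m \<noteq> {}" using assms by (auto simp: torsion_def intro!: exI[of _ 0])
  qed (use assms mod in \<open>auto simp: torsion_def carrier_integer_mod_group distrib_left
        mult_integer_mod_group inv_integer_mod_group\<close>)
qed

text \<open>The preimage \<open>L\<close> of \<open>H\<close> in the integers is an additive
  subgroup, so it consists of the multiples of its least positive element \<open>d\<close>. As
  \<open>n\<close> lies in \<open>L\<close>, \<open>n = d * m\<close>, and the multiples of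
  \<open>d\<close> below \<open>n\<close> form the \<open>m\<close>-torsion.\<close>

lemma subgroup_integer_mod_group_iff:
  assumes n: "n > 0"
  shows "subgroup H (integer_mod_group n) \<longleftrightarrow> (\<exists>m. m dvd n \<and> H = torsion n m)"
proof
  interpret group "integer_mod_group n" by simp
  assume H: "subgroup H (integer_mod_group n)"
  interpret H: subgroup H "integer_mod_group n" by fact
  have sub: "H \<subseteq> {0..<int n}"
    using H.subset n by (simp add: carrier_integer_mod_group)
  define L where "L = {x. x mod int n \<in> H}"
  have L_add: "x + y \<in> L" if "x \<in> L" "y \<in> L" for x y
    using H.m_closed[of "x mod int n" "y mod int n"] that n
    by (simp add: L_def mult_integer_mod_group mod_add_eq)
  have L_uminus: "- x \<in> L" if "x \<in> L" for x
    using H.m_inv_closed[of "x mod int n"] that n sub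
    by (auto simp: L_def inv_integer_mod_group carrier_integer_mod_group mod_minus_eq)
  have L_0: "0 \<in> L" using H.one_closed by (simp add: L_def)
  have L_n: "int n \<in> L" using L_0 by (simp add: L_def)
  define d where "d = (LEAST d. d > 0 \<and> int d \<in> L)"
  have d: "d > 0" "int d \<in> L"
    using LeastI[of "\<lambda>d. d > 0 \<and> int d \<in> L" n] n L_n by (auto simp: d_def)
  have d_le: "d \<le> e" if "e > 0" "int e \<in> L" for e
    using that by (auto simp: d_def intro: Least_le)
  have mult_nat: "int k * int d \<in> L" for k
    by (induction k) (auto simp: L_0 distrib_right intro: L_add d)
  have mult: "k * int d \<in> L" for k
    by (cases k rule: int_cases2) (use mult_nat L_uminus in fastforce)+
  have L_iff: "x \<in> L \<longleftrightarrow> int d dvd x" for x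
  proof
    assume "x \<in> L"
    \<comment> \<open>Division with remainder: the remainder lies in \<open>L\<close> and is below
      \<open>d\<close>, so minimality of \<open>d\<close> makes it zero.\<close>
    moreover have "x mod int d = x + (- (x div int d)) * int d"
      by (simp add: minus_div_mult_eq_mod[symmetric])
    ultimately have "x mod int d \<in> L"
      using L_add mult by presburger
    moreover have "0 \<le> x mod int d" "x mod int d < int d"
      using d(1) by auto
    ultimately have "x mod int d = 0"
      using d_le[of "nat (x mod int d)"] by (cases "x mod int d = 0") auto
    then show "int d dvd x" by auto
  qed (use mult in \<open>auto simp: mult.commute elim!: dvdE\<close>)
  have "d dvd n" using L_n L_iff by simp
  then obtain m where m: "n = d * m" by blast
  have "x \<in> H \<longleftrightarrow> x \<in> torsion n m" for x
  proof (cases "x \<in> {0..<int n}")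
    case True
    then have "x \<in> H \<longleftrightarrow> int d dvd x"
      using L_iff[of x] by (simp add: L_def)
    then show ?thesis using True m n by (simp add: torsion_def mult.commute[of "int d"])
  qed (use sub in \<open>auto simp: torsion_def\<close>)
  then show "\<exists>m. m dvd n \<and> H = torsion n m"
    using m by (intro exI[of _ m]) auto
qed (use subgroup_torsion n in auto)

text \<open>The trivial subgroup is the 1-torsion, and distinct divisors of \<open>n\<close> have
  distinct torsion subgroups; \<open>gcd a b\<close> divides \<open>n\<close> because
  \<open>a\<close> does.\<close>

lemma torsion_Int_trivial_iff:
  assumes "n > 0" "a dvd n"
  shows "torsion n a \<inter> torsion n b = {0} \<longleftrightarrow> coprime a b"
proof -
  have "torsion n (gcd a b) = torsion n 1 \<longleftrightarrow> gcd a b = 1"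
    using assms by (intro torsion_eq_iff) (auto intro: dvd_trans[OF gcd_dvd1])
  then show ?thesis
    using assms by (simp add: torsion_Int torsion_1[symmetric] coprime_iff_gcd_eq_1
        del: One_nat_def)
qed

section \<open>Vertices and centres as divisors of \<open>n\<close>\<close>

lemma nontrivial_proper_subgroups_integer_mod_group:
  assumes n: "n > 0"
  shows "nontrivial_proper_subgroups (integer_mod_group n) =
    torsion n ` {m. m dvd n \<and> m \<noteq> 1 \<and> m \<noteq> n}"
  using torsion_eq_iff[OF n] unfolding nontrivial_proper_subgroups_def
  by (auto simp: subgroup_integer_mod_group_iff[OF n] torsion_1[OF n, symmetric]
      torsion_self[OF n, symmetric] simp del: One_nat_def)

text \<open>If some \<open>b\<close> is coprime to \<open>m\<close>, any prime factor of
  \<open>b\<close> is a prime of \<open>n\<close> missing from \<open>m\<close>; conversely such a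
  prime serves as \<open>b\<close>. A missing prime also forces \<open>m \<noteq> n\<close>.\<close>

lemma intersection_vertices_integer_mod_group:
  assumes n: "n > 0"
  shows "intersection_vertices (integer_mod_group n) =
    torsion n ` {m. m dvd n \<and> m \<noteq> 1 \<and> (\<exists>p. prime p \<and> p dvd n \<and> \<not> p dvd m)}"
proof -
  have "(m \<noteq> n \<and> (\<exists>b. b dvd n \<and> b \<noteq> 1 \<and> b \<noteq> n \<and> coprime m b)) \<longleftrightarrow>
    (\<exists>p. prime p \<and> p dvd n \<and> \<not> p dvd m)" if m: "m dvd n" "m \<noteq> 1" for m
  proof
    assume "m \<noteq> n \<and> (\<exists>b. b dvd n \<and> b \<noteq> 1 \<and> b \<noteq> n \<and> coprime m b)"
    then obtain b where b: "b dvd n" "b \<noteq> 1" "coprime m b" by blast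
    then obtain p where p: "prime p" "p dvd b" using prime_factor_nat by blast
    then have "\<not> p dvd m"
      using b by (meson coprime_common_divisor not_prime_unit)
    then show "\<exists>p. prime p \<and> p dvd n \<and> \<not> p dvd m"
      using p b dvd_trans by blast
  next
    assume "\<exists>p. prime p \<and> p dvd n \<and> \<not> p dvd m"
    then obtain p where p: "prime p" "p dvd n" "\<not> p dvd m" by blast
    then have "coprime m p" "p \<noteq> 1"
      using prime_imp_coprime[of p m] by (auto simp: coprime_commute)
    moreover have "p \<noteq> n"
      \<comment> \<open>If \<open>n\<close> were the prime \<open>p\<close>, its divisor
        \<open>m \<noteq> 1\<close> would be \<open>p\<close>, which does not divide
        \<open>m\<close>.\<close>
      using p m by (metis dvd_refl prime_nat_iff)
    ultimately show "m \<noteq> n \<and> (\<exists>b. b dvd n \<and> b \<noteq> 1 \<and> b \<noteq> n \<and> coprime m b)"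
      using p by auto
  qed
  moreover have "intersection_vertices (integer_mod_group n) =
      torsion n ` {m. m dvd n \<and> m \<noteq> 1 \<and> m \<noteq> n \<and> (\<exists>b. b dvd n \<and> b \<noteq> 1 \<and> b \<noteq> n \<and> coprime m b)}"
    unfolding intersection_vertices_def nontrivial_proper_subgroups_integer_mod_group[OF n]
    using torsion_Int_trivial_iff[OF n] by (auto simp del: One_nat_def)
  ultimately show ?thesis by (auto intro!: image_cong)
qed

lemma omega_ge_2_obtain_prime:
  assumes "omega n \<ge> 2"
  obtains p where "prime p" "p dvd n" "p \<noteq> q"
proof -
  have "\<not> prime_factors n \<subseteq> {q}"
    using assms card_mono[of "{q}" "prime_factors n"] by (auto simp: omega_def)
  then show ?thesis using that by (auto simp: prime_factors_dvd)
qed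

lemma star_integer_mod_group_iff:
  assumes n: "n > 0"
  shows "star_hypergraph (intersection_hypergraph (integer_mod_group n)) \<longleftrightarrow>
    (\<exists>m. m dvd n \<and> m \<noteq> 1 \<and> (\<exists>p. prime p \<and> p dvd n \<and> \<not> p dvd m) \<and>
      (\<forall>k. k dvd n \<and> k \<noteq> 1 \<and> (\<exists>p. prime p \<and> p dvd n \<and> \<not> p dvd k) \<and> k \<noteq> m \<longrightarrow> coprime m k))"
    (is "_ \<longleftrightarrow> ?R")
proof -
  interpret group "integer_mod_group n" by simp
  have fin: "finite (carrier (integer_mod_group n))"
    using n by (simp add: carrier_integer_mod_group)
  let ?D = "{m. m dvd n \<and> m \<noteq> 1 \<and> (\<exists>p. prime p \<and> p dvd n \<and> \<not> p dvd m)}"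
  have "star_hypergraph (intersection_hypergraph (integer_mod_group n)) \<longleftrightarrow>
    (\<exists>m\<in>?D. \<forall>k\<in>?D. torsion n k \<noteq> torsion n m \<longrightarrow> torsion n m \<inter> torsion n k = {0})"
    unfolding star_intersection_hypergraph_iff[OF fin] intersection_vertices_integer_mod_group[OF n]
      one_integer_mod_group by (simp only: bex_simps ball_simps)
  also have "\<dots> \<longleftrightarrow> (\<exists>m\<in>?D. \<forall>k\<in>?D. k \<noteq> m \<longrightarrow> coprime m k)"
    using n by (intro bex_cong ball_cong refl) (simp add: torsion_eq_iff torsion_Int_trivial_iff)
  also have "\<dots> \<longleftrightarrow> ?R" by blast
  finally show ?thesis .
qed

theorem theorem3p6:
  fixes n :: nat
  assumes "n > 0" and "omega n \<ge> 2"
  shows "star_hypergraph (intersection_hypergraph (integer_mod_group n)) \<longleftrightarrow>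
    (\<exists>p\<^sub>1 p\<^sub>2 \<alpha>\<^sub>1 :: nat. prime p\<^sub>1 \<and> prime p\<^sub>2 \<and> p\<^sub>1 \<noteq> p\<^sub>2 \<and> \<alpha>\<^sub>1 > 0 \<and> n = p\<^sub>1 ^ \<alpha>\<^sub>1 * p\<^sub>2)"
  (is "?L \<longleftrightarrow> ?R")
proof
  assume ?L
  then obtain m where m: "m dvd n" "m \<noteq> 1"
    and centre: "\<And>k p. k dvd n \<Longrightarrow> k \<noteq> 1 \<Longrightarrow> prime p \<Longrightarrow> p dvd n \<Longrightarrow> \<not> p dvd k \<Longrightarrow> k \<noteq> m \<Longrightarrow> coprime m k"
    unfolding star_integer_mod_group_iff[OF assms(1)] by blast
  obtain q where q: "prime q" "q dvd m" using m prime_factor_nat by blast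
  obtain p where p: "prime p" "p dvd n" "p \<noteq> q" using omega_ge_2_obtain_prime[OF assms(2)] .
  have qn: "q dvd n" using q m dvd_trans by blast
  have "\<not> p dvd q" using p q primes_dvd_imp_eq by blast
  then have mq: "m = q"
    using centre[of q p] qn p q by (metis coprime_common_divisor dvd_refl not_prime_unit not_prime_1)
  have r: "r = p" if "prime r" "q * r dvd n" for r
  proof (rule ccontr)
    assume "r \<noteq> p"
    then have "\<not> p dvd q * r"
      using p q that by (metis prime_dvd_mult_iff primes_dvd_imp_eq)
    moreover have "q * r \<noteq> q" "q * r \<noteq> 1" using q that by (auto simp: prime_nat_iff)
    ultimately have "coprime q (q * r)"
      using centre[of "q * r" p] that p mq by blast
    then show False using q by simp
  qed
  obtain k where k: "n = q * k" using qn by blast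
  have "k > 0" using k assms by simp
  \<comment> \<open>This makes the exponent of \<open>p\<close> in \<open>k\<close> positive at the
    end.\<close>
  have "p dvd k" using p q(1) k primes_dvd_imp_eq[OF p(1) q(1)] by (auto simp: prime_dvd_mult_iff)
  moreover have "s = p" if "prime s" "s dvd k" for s
    using that r[of s] k by simp
  ultimately have "prime_factors k = {p}"
    using p(1) \<open>k > 0\<close> unfolding prime_factors_dvd[OF gr_implies_not0[OF \<open>k > 0\<close>]] by blast
  then have "k = p ^ multiplicity p k"
    using prime_factorization_nat[OF \<open>k > 0\<close>] by simp
  moreover have "multiplicity p k > 0"
    using p \<open>p dvd k\<close> \<open>k > 0\<close> by (simp add: prime_multiplicity_gt_zero_iff)
  ultimately show ?R
    using p q k by (metis mult.commute)
next
  assume ?R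
  then obtain p q a where pq: "prime p" "prime q" "p \<noteq> q" "a > 0" and n: "n = p ^ a * q"
    by blast
  have cop: "coprime q k" if k: "k dvd n" "k \<noteq> 1" "prime r" "r dvd n" "\<not> r dvd k" "k \<noteq> q" for k r
  proof -
    \<comment> \<open>The prime \<open>r\<close> missing from \<open>k\<close> is \<open>p\<close>
      or \<open>q\<close>. If it is \<open>p\<close>, then \<open>k\<close> divides
      \<open>q\<close>, so \<open>k\<close> is 1 or \<open>q\<close>, both excluded. If it is
      \<open>q\<close>, coprimality is immediate.\<close>
    have "r = p \<or> r = q"
      using k pq n by (metis prime_dvd_mult_iff prime_dvd_power primes_dvd_imp_eq)
    moreover have False if "r = p"
    proof -
      have "coprime k (p ^ a)"
        using k(3,5) that prime_imp_coprime[of p k] by (simp add: coprime_commute)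
      then have "k dvd q" using k n by (simp add: coprime_dvd_mult_right_iff)
      then show False using k pq by (auto simp: prime_nat_iff)
    qed
    ultimately show ?thesis using k by (auto intro: prime_imp_coprime)
  qed
  have "q dvd n" "q \<noteq> 1" "p dvd n" "\<not> p dvd q"
    using pq n by (auto dest: primes_dvd_imp_eq simp: dvd_power)
  then show ?L
    unfolding star_integer_mod_group_iff[OF assms(1)] using cop pq by blast
qed

end
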